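(* Let $n$ be any positive odd integer, and let $x$ be a real number such that $kx$ is not an integer multiple of $\pi$ for any $k=1,\ldots,n$. Then $$\sum_{k=1}^n(-1)^k\cot(kx)\,\sin\bigl(k(n-k)x\bigr)=\frac{1-n}{2}.$$ *)

theory Defs
  imports Complex_Main
begin

end

theory Submission
  imports Defs
begin

text \<open>
  The function \<open>cot y * sin (m * y)\<close> is a cosine polynomial in \<open>y\<close> whose frequencies have the parity
  of \<open>m\<close>. For \<open>y = k * x\<close> and \<open>m = n - k\<close> with \<open>n\<close> odd, the nonconstant part of the whole sum runs
  over pairs \<open>j, k \<ge> 1\<close> with \<open>j + k\<close> odd and \<open>j + k \<le> n\<close>; apart from the sign \<open>(-1) ^ k\<close> its terms
  are symmetric in \<open>j\<close> and \<open>k\<close>, so it cancels under the exchange of \<open>j\<close> and \<open>k\<close>. What remains is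
  the contribution \<open>-1\<close> of each odd \<open>k < n\<close>.
\<close>

text \<open>Induction in steps of two: sin((l+2)y) - sin(ly) = 2 cos((l+1)y) sin y, and the factor
  cot y turns the right side into 2 cos((l+1)y) cos y = cos((l+2)y) + cos(ly).\<close>

lemma cot_times_sin_multiple:
  fixes y :: real
  assumes "sin y \<noteq> 0" and "m > 0"
  shows "cot y * sin (real m * y) =
    (if even m then 1 else 0) + cos (real m * y)
      + (\<Sum>j\<in>{1..<m}. if even (j + m) then 2 * cos (real j * y) else 0)"
  using \<open>m > 0\<close>
proof (induction m rule: less_induct)
  case (less m)
  consider "m = 1" | "m = 2" | l where "m = l + 2" "l > 0"
  proof -
    assume *: "m = 1 \<Longrightarrow> thesis" "m = 2 \<Longrightarrow> thesis" "\<And>l. m = l + 2 \<Longrightarrow> l > 0 \<Longrightarrow> thesis"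
    show thesis
      using less.prems *(1,2) *(3)[of "m - 2"] by linarith
  qed
  then show ?case
  proof cases
    case 1
    then show ?thesis using assms by (simp add: cot_def)
  next
    case 2
    have "{1..<2} = {1::nat}" by auto
    with 2 show ?thesis using assms
      by (simp add: cot_def sin_double cos_double_cos power2_eq_square)
  next
    case 3
    have IH: "cot y * sin (real l * y) = (if even l then 1 else 0) + cos (real l * y)
      + (\<Sum>j\<in>{1..<l}. if even (j + l) then 2 * cos (real j * y) else 0)"
      using less.IH 3 by simp
    \<comment> \<open>Of the two new indices, \<open>l + 1\<close> has the wrong parity and adds
      nothing. The term 2 cos(ly) at \<open>l\<close> combines the end term of \<open>IH\<close>
      with the cos(ly) produced by \<open>step\<close>.\<close>
    have split: "{1..<m} = insert (l + 1) (insert l {1..<l})"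
      using 3 by auto
    define a where "a = real l * y + y"
    have angle: "real m * y = a + y" "real l * y = a - y"
      using 3 by (simp_all add: a_def algebra_simps)
    have "sin (a + y) - sin (a - y) = 2 * cos a * sin y"
      by (simp add: sin_add sin_diff)
    then have "cot y * (sin (a + y) - sin (a - y)) = 2 * cos a * cos y"
      using assms(1) by (simp only: cot_def) simp
    then have "cot y * sin (real m * y) - cot y * sin (real l * y) = 2 * cos a * cos y"
      by (simp only: angle right_diff_distrib)
    also have "\<dots> = cos (real m * y) + cos (real l * y)"
      by (simp add: angle cos_add cos_diff)
    finally have step: "cot y * sin (real m * y)
        = cot y * sin (real l * y) + (cos (real m * y) + cos (real l * y))" by simp
    show ?thesis unfolding step IH split using 3 by simp
  qed
qed

lemma sum_antisymmetric_eq_0: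
  fixes F :: "'a \<Rightarrow> 'a \<Rightarrow> real"
  assumes "\<And>i j. i \<in> A \<Longrightarrow> j \<in> A \<Longrightarrow> F j i = - F i j"
  shows "(\<Sum>i\<in>A. \<Sum>j\<in>A. F i j) = 0"
proof -
  have "(\<Sum>i\<in>A. \<Sum>j\<in>A. F i j) = (\<Sum>i\<in>A. \<Sum>j\<in>A. F j i)"
    by (rule sum.swap)
  also have "\<dots> = (\<Sum>i\<in>A. \<Sum>j\<in>A. - F i j)"
    by (intro sum.cong refl assms)
  also have "\<dots> = - (\<Sum>i\<in>A. \<Sum>j\<in>A. F i j)"
    by (simp only: sum_negf)
  finally show ?thesis by simp
qed

lemma sum_odd_indicator:
  "(\<Sum>k\<in>{1..<2 * p + 1}. if odd k then - 1 else 0) = - real p"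
  by (induction p) simp_all

theorem mainTheorem2:
  fixes n :: nat and x :: real
  assumes "n > 0" and "odd n"
    and "\<And>k::nat. k \<in> {1..n} \<Longrightarrow> \<not> (\<exists>m::int. real k * x = of_int m * pi)"
  shows "(\<Sum>k=1..n. (-1) ^ k * cot (real k * x) * sin (real k * (real n - real k) * x))
           = (1 - real n) / 2"
proof -
  \<comment> \<open>The coefficient of cos(jkx) in the expansion for m = n - k depends only on s = j
    + k: since n is odd, j + m is even iff s is odd, and j < m iff s < n. This makes it symmetric in
    j and k.\<close>
  define w :: "nat \<Rightarrow> real"
    where "w s = (if s = n then 1 else if odd s \<and> s < n then 2 else 0)" for s
  define F where "F k j = (-1) ^ k * (w (j + k) * cos (real j * real k * x))" for k j
  have summand: "(-1) ^ k * cot (real k * x) * sin (real k * (real n - real k) * x)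
      = (if odd k then - 1 else 0) + (\<Sum>j\<in>{1..<n}. F k j)" if k: "k \<in> {1..<n}" for k
  proof -
    define y where "y = real k * x"
    define m where "m = n - k"
    have nz: "sin y \<noteq> 0"
      using assms(3)[of k] k unfolding y_def sin_zero_iff_int2 by auto
    have m: "m > 0" "m < n" "m + k = n" using k by (auto simp: m_def)
    then have parity: "even m \<longleftrightarrow> odd k" using \<open>odd n\<close> by (metis even_add)
    have arg: "real k * (real n - real k) * x = real m * y"
      using k by (simp add: m_def y_def of_nat_diff)
    have "(\<Sum>j\<in>{1..<n}. w (j + k) * cos (real j * y))
        = (\<Sum>j\<in>insert m {1..<m}. w (j + k) * cos (real j * y))"
      \<comment> \<open>The weight vanishes for j > m, so j may range over a set independent of k,
        as the exchange of indices requires.\<close>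
      using m by (intro sum.mono_neutral_right) (auto simp: w_def)
    also have "\<dots> = cos (real m * y) + (\<Sum>j\<in>{1..<m}. w (j + k) * cos (real j * y))"
      using m by (simp add: w_def)
    also have "(\<Sum>j\<in>{1..<m}. w (j + k) * cos (real j * y))
        = (\<Sum>j\<in>{1..<m}. if even (j + m) then 2 * cos (real j * y) else 0)"
      using m parity by (intro sum.cong) (auto simp: w_def)
    finally have "cot y * sin (real m * y)
        = (if odd k then 1 else 0) + (\<Sum>j\<in>{1..<n}. w (j + k) * cos (real j * y))"
      using cot_times_sin_multiple[OF nz m(1)] parity by simp
    moreover have "(\<Sum>j\<in>{1..<n}. F k j)
        = (-1) ^ k * (\<Sum>j\<in>{1..<n}. w (j + k) * cos (real j * y))"
      by (simp add: F_def y_def sum_distrib_left mult.assoc)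
    moreover have "(-1) ^ k * (if odd k then 1 else 0) = (if odd k then - 1 else 0 :: real)"
      by simp
    ultimately show ?thesis
      by (simp only: arg y_def[symmetric] mult.assoc[of "(-1) ^ k"] distrib_left)
  qed
  have antisym: "F j k = - F k j" for j k
  proof (cases "odd (j + k)")
    case True
    \<comment> \<open>Indices of opposite parity carry opposite signs, while weight and cosine are
      symmetric.\<close>
    then have "(-1) ^ j = - ((-1) ^ k :: real)" by (cases "even j") auto
    then show ?thesis by (simp add: F_def add.commute mult.commute)
  next
    case False
    then have "w (j + k) = 0" using \<open>odd n\<close> by (auto simp: w_def)
    then show ?thesis by (simp add: F_def add.commute)
  qed
  obtain p where p: "n = 2 * p + 1" using \<open>odd n\<close> by (rule oddE)
  \<comment> \<open>The term k = n drops out because its sine factor is sin 0.\<close>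
  have "{1..n} = insert n {1..<n}" using \<open>n > 0\<close> by auto
  then have "(\<Sum>k=1..n. (-1) ^ k * cot (real k * x) * sin (real k * (real n - real k) * x))
      = (\<Sum>k\<in>{1..<n}. (-1) ^ k * cot (real k * x) * sin (real k * (real n - real k) * x))"
    by simp
  also have "\<dots> = (\<Sum>k\<in>{1..<n}. if odd k then - 1 else 0) + (\<Sum>k\<in>{1..<n}. \<Sum>j\<in>{1..<n}. F k j)"
    by (simp only: summand sum.distrib cong: sum.cong)
  also have "(\<Sum>k\<in>{1..<n}. \<Sum>j\<in>{1..<n}. F k j) = 0"
    using antisym by (rule sum_antisymmetric_eq_0)
  also have "(\<Sum>k\<in>{1..<n}. if odd k then - 1 else 0) = - real p"
    unfolding p by (rule sum_odd_indicator)
  finally show ?thesis using p by simp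
qed

end
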